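(* Let $n\ge 2$, let $P_n$ be the polycyclic monoid on $n$ generators, and let $a,b\in P_n$. Then $a\sim_c b$ if and only if one of the following conditions is satisfied: (a) $a=b=0$; (b) $\widetilde a=\widetilde b$; or (c) $\widetilde a,\widetilde b\in (A_n^{-1})^*$ and $\widetilde a\sim_p\widetilde b$ in the free monoid $(A_n^{-1})^*$.
   Context: For elements $a,b$ of a monoid $M$, $a\sim_p b$ means that there exist $u,v\in M$ with $a=uv$ and $b=vu$. For a monoid $M$ with zero and $a\in M\setminus\{0\}$, let $\mathbb P(a)=\{g\in M:(\forall m\in M)\ mag=0\Rightarrow ma=0\}$, and let $\mathbb P(0)=\{0\}$; if $M$ has no zero, $\mathbb P(a)=M$ for all $a\in M$. Define $a\sim_c b$ to mean: there exist $g\in\mathbb P(a)$ and $h\in\mathbb P(b)$ with $ag=gb$ and $bh=ha$. Polycyclic monoid: let $n\ge2$, $A_n=\{p_1,\dots,p_n\}$, $A_n^{-1}=\{p_1^{-1},\dots,p_n^{-1}\}$ a disjoint copy, $\Sigma=A_n\cup A_n^{-1}$, $\Sigma_0=\Sigma\cup\{0\}$. Put $(p_i^{-1})^{-1}=p_i$, $1^{-1}=1$ (where $1$ is the empty word), and $(xw)^{-1}=w^{-1}x^{-1}$ for $x\in\Sigma$, $w\in\Sigma^*$. $P_n$ is the monoid generated by $\Sigma_0$ with defining relations (read as left-to-right rewriting rules) $p_i^{-1}p_i=1$, $p_i^{-1}p_j=0$ for $i\ne j$, and $x0=0$, $0x=0$, $00=0$ for $x\in\Sigma$. The element $0$ is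 the zero of $P_n$. Each nonzero element of $P_n$ is represented by a unique irreducible word, which has the form $yx^{-1}$ with $x,y\in A_n^*$; elements of $P_n$ are identified with their irreducible words ($0$ being the irreducible word for the zero). An irreducible word is cyclically reduced if it is empty or $0$, or if its first letter $c$ and last letter $d$ satisfy $c\ne d^{-1}$. For $a\in P_n$ the word $\widetilde a$ is defined by: $\widetilde a=a$ if $a$ is cyclically reduced; otherwise write $a=r\,yx^{-1}\,r^{-1}$ with $r,x,y\in A_n^*$ and $yx^{-1}$ cyclically reduced (such a decomposition exists and is unique), and put $\widetilde a=yx^{-1}$. *)

theory Defs
  imports "HOL-Algebra.Group"
begin

section \<open>Conjugacy relations in an arbitrary monoid\<close>

definition sim_p :: "('a, 'b) monoid_scheme \<Rightarrow> 'a \<Rightarrow> 'a \<Rightarrow> bool" where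
  "sim_p M a b \<longleftrightarrow>
     (\<exists>u\<in>carrier M. \<exists>v\<in>carrier M. a = u \<otimes>\<^bsub>M\<^esub> v \<and> b = v \<otimes>\<^bsub>M\<^esub> u)"

definition is_zero :: "('a, 'b) monoid_scheme \<Rightarrow> 'a \<Rightarrow> bool" where
  "is_zero M z \<longleftrightarrow>
     z \<in> carrier M \<and> (\<forall>x\<in>carrier M. z \<otimes>\<^bsub>M\<^esub> x = z \<and> x \<otimes>\<^bsub>M\<^esub> z = z)"

definition conjugators :: "('a, 'b) monoid_scheme \<Rightarrow> 'a \<Rightarrow> 'a set" where
  "conjugators M a =
     (if \<exists>z. is_zero M z
      then if is_zero M a then {a}
           else {g \<in> carrier M. \<forall>m\<in>carrier M.
                   is_zero M (m \<otimes>\<^bsub>M\<^esub> a \<otimes>\<^bsub>M\<^esub> g) \<longrightarrow> is_zero M (m \<otimes>\<^bsub>M\<^esub> a)}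
      else carrier M)"

definition sim_c :: "('a, 'b) monoid_scheme \<Rightarrow> 'a \<Rightarrow> 'a \<Rightarrow> bool" where
  "sim_c M a b \<longleftrightarrow>
     a \<in> carrier M \<and> b \<in> carrier M \<and>
     (\<exists>g\<in>conjugators M a. \<exists>h\<in>conjugators M b.
        a \<otimes>\<^bsub>M\<^esub> g = g \<otimes>\<^bsub>M\<^esub> b \<and> b \<otimes>\<^bsub>M\<^esub> h = h \<otimes>\<^bsub>M\<^esub> a)"

definition free_monoid :: "'a set \<Rightarrow> 'a list monoid" where
  "free_monoid A = \<lparr>carrier = lists A, mult = (@), one = []\<rparr>"


section \<open>The polycyclic monoid\<close>

text \<open>\<open>Pos i\<close> stands for \<open>p\<^sub>i\<close>, \<open>Neg i\<close> for its formal inverse, and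
  \<open>Zero\<close> for the generator \<open>0\<close>.\<close>

datatype letter = Pos nat | Neg nat | Zero

definition A_pos :: "nat \<Rightarrow> letter set" where
  "A_pos n = Pos ` {1..n}"

definition A_neg :: "nat \<Rightarrow> letter set" where
  "A_neg n = Neg ` {1..n}"

definition Sigma0 :: "nat \<Rightarrow> letter set" where
  "Sigma0 n = A_pos n \<union> A_neg n \<union> {Zero}"

text \<open>The inverse is only meaningful on letters other than \<open>Zero\<close>; the value at
  \<open>Zero\<close> is a dummy that no definition below depends on.\<close>

fun inv_letter :: "letter \<Rightarrow> letter" where
  "inv_letter (Pos i) = Neg i"
| "inv_letter (Neg i) = Pos i"
| "inv_letter Zero = Zero"

fun inv_word :: "letter list \<Rightarrow> letter list" where
  "inv_word [] = []"
| "inv_word (x # w) = inv_word w @ [inv_letter x]"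

inductive pc_rule :: "nat \<Rightarrow> letter list \<Rightarrow> letter list \<Rightarrow> bool" for n where
  cancel: "i \<in> {1..n} \<Longrightarrow> pc_rule n [Neg i, Pos i] []"
| clash: "i \<in> {1..n} \<Longrightarrow> j \<in> {1..n} \<Longrightarrow> i \<noteq> j \<Longrightarrow> pc_rule n [Neg i, Pos j] [Zero]"
| right_zero: "x \<in> A_pos n \<union> A_neg n \<Longrightarrow> pc_rule n [x, Zero] [Zero]"
| left_zero: "x \<in> A_pos n \<union> A_neg n \<Longrightarrow> pc_rule n [Zero, x] [Zero]"
| zero_zero: "pc_rule n [Zero, Zero] [Zero]"

inductive pc_step :: "nat \<Rightarrow> letter list \<Rightarrow> letter list \<Rightarrow> bool" for n where
  "u \<in> lists (Sigma0 n) \<Longrightarrow> v \<in> lists (Sigma0 n) \<Longrightarrow> pc_rule n l r \<Longrightarrow>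
     pc_step n (u @ l @ v) (u @ r @ v)"

definition pc_cong :: "nat \<Rightarrow> (letter list \<times> letter list) set" where
  "pc_cong n = {(u, v). u \<in> lists (Sigma0 n) \<and> v \<in> lists (Sigma0 n) \<and> equivclp (pc_step n) u v}"

definition polycyclic :: "nat \<Rightarrow> letter list set monoid" where
  "polycyclic n =
     \<lparr>carrier = lists (Sigma0 n) // pc_cong n,
      mult = (\<lambda>X Y. \<Union>u\<in>X. \<Union>v\<in>Y. pc_cong n `` {u @ v}),
      one = pc_cong n `` {[]}\<rparr>"

definition pc_zero :: "nat \<Rightarrow> letter list set" where
  "pc_zero n = pc_cong n `` {[Zero]}"

definition irreducible_word :: "nat \<Rightarrow> letter list \<Rightarrow> bool" where
  "irreducible_word n w \<longleftrightarrow> w \<in> lists (Sigma0 n) \<and> (\<nexists>v. pc_step n w v)"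

text \<open>The rewriting system is terminating and confluent, so every class contains
  exactly one irreducible word.\<close>

definition normal_form :: "nat \<Rightarrow> letter list set \<Rightarrow> letter list" where
  "normal_form n a = (THE w. w \<in> a \<and> irreducible_word n w)"

definition cyclically_reduced :: "nat \<Rightarrow> letter list \<Rightarrow> bool" where
  "cyclically_reduced n w \<longleftrightarrow>
     irreducible_word n w \<and> (w = [] \<or> w = [Zero] \<or> hd w \<noteq> inv_letter (last w))"

definition core :: "nat \<Rightarrow> letter list \<Rightarrow> letter list" where
  "core n w =
     (if cyclically_reduced n w then w
      else THE c. \<exists>r\<in>lists (A_pos n). \<exists>x\<in>lists (A_pos n). \<exists>y\<in>lists (A_pos n).
             c = y @ inv_word x \<and> cyclically_reduced n c \<and> w = r @ c @ inv_word r)"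

text \<open>The word written \<open>a\<close> with a tilde, for an element \<open>a\<close> of the polycyclic monoid.\<close>

definition tilde :: "nat \<Rightarrow> letter list set \<Rightarrow> letter list" where
  "tilde n a = core n (normal_form n a)"

end

theory Submission
  imports Defs
begin

text \<open>A nonzero element \<open>y x\<inverse>\<close> is a pair of positive words \<open>(y, x)\<close>, and the product
  \<open>y x\<inverse> v u\<inverse>\<close> is nonzero iff one of \<open>x\<close>, \<open>v\<close> is a prefix of the other. Because there are at
  least two generators, \<open>v u\<inverse>\<close> lies in \<open>\<P>(y x\<inverse>)\<close> iff \<open>v\<close> is a prefix of \<open>x\<close>: every extension
  of \<open>x\<close> occurs as the negative part of some \<open>m y x\<inverse>\<close>. Write \<open>x = v t\<close>, so that
  \<open>a g = y (u t)\<inverse>\<close>. Comparing with \<open>g b\<close> for \<open>b = y\<^sub>2 x\<^sub>2\<inverse>\<close> leaves two possibilities. If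
  \<open>y\<^sub>2 = u s\<close>, then \<open>a = v s t\<inverse> v\<inverse>\<close> and \<open>b = u s t\<inverse> u\<inverse>\<close>. If \<open>u = y\<^sub>2 s\<close>, then
  \<open>a = v t\<inverse> v\<inverse>\<close> and \<open>y\<^sub>2 s t = x\<^sub>2 s\<close>, so that \<open>x\<^sub>2 = y\<^sub>2 t'\<close> with \<open>s t = t' s\<close>, and \<open>t\<close>, \<open>t'\<close>
  are cyclic shifts of each other.\<close>

section \<open>The polycyclic monoid as pairs of positive words\<close>

text \<open>\<open>Some (y, x)\<close> stands for \<open>y x\<inverse>\<close> and \<open>None\<close> for the zero; \<open>act c\<close> is left multiplication
  by the letter \<open>c\<close>.\<close>

type_synonym elt = "(nat list \<times> nat list) option"

fun act :: "letter \<Rightarrow> elt \<Rightarrow> elt" where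
  "act _ None = None"
| "act (Pos i) (Some (y, x)) = Some (i # y, x)"
| "act (Neg i) (Some ([], x)) = Some ([], x @ [i])"
| "act (Neg i) (Some (j # y, x)) = (if i = j then Some (y, x) else None)"
| "act Zero (Some _) = None"

definition eval_word :: "letter list \<Rightarrow> elt" where
  "eval_word w = foldr act w (Some ([], []))"

text \<open>The second component is stored uninverted, so its word is reversed; hence prepending
  \<open>Neg i\<close> to a negative word means appending \<open>i\<close> to \<open>x\<close>, as
  \<open>act\<close> does.\<close>

fun word_of :: "elt \<Rightarrow> letter list" where
  "word_of None = [Zero]"
| "word_of (Some (y, x)) = map Pos y @ map Neg (rev x)"

definition mul :: "elt \<Rightarrow> elt \<Rightarrow> elt" where
  "mul e f = foldr act (word_of e) f"

definition elems :: "nat \<Rightarrow> elt set" where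
  "elems n = insert None (Some ` (lists {1..n} \<times> lists {1..n}))"

lemma Some_in_elems [simp]:
  "Some (y, x) \<in> elems n \<longleftrightarrow> y \<in> lists {1..n} \<and> x \<in> lists {1..n}"
  by (auto simp: elems_def)

lemma None_in_elems [simp]: "None \<in> elems n"
  by (simp add: elems_def)

lemma act_Zero [simp]: "act Zero e = None"
  by (cases e) auto

lemma foldr_act_None [simp]: "foldr act w None = None"
  by (induction w) auto

lemma foldr_act_Pos: "foldr act (map Pos y) (Some (v, u)) = Some (y @ v, u)"
  by (induction y) auto

text \<open>The letters of \<open>x\<close> act in order, first letter first, each deleting an equal
  first letter of \<open>v\<close>. Either \<open>x\<close> is used up and leaves \<open>p\<close>,
  or \<open>v\<close> is used up and the rest \<open>s\<close> of \<open>x\<close> joins the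
  negative part; a mismatch gives \<open>None\<close>.\<close>

lemma foldr_act_Neg_eq_Some:
  "foldr act (map Neg (rev x)) (Some (v, u)) = Some (p, q) \<longleftrightarrow>
     v = x @ p \<and> q = u \<or> (\<exists>s. x = v @ s \<and> p = [] \<and> q = u @ s)"
proof (induction x arbitrary: v u)
  case Nil
  then show ?case by auto
next
  case (Cons i x)
  show ?case
  proof (cases v)
    case Nil
    have "foldr act (map Neg (rev x)) (Some ([], u @ [i])) = Some (p, q) \<longleftrightarrow>
        p = [] \<and> q = u @ i # x"
      unfolding Cons.IH by auto
    with Nil show ?thesis by auto
  next
    case v: (Cons j v')
    then show ?thesis using Cons.IH[of v' u] by auto
  qed
qed

lemma mul_None [simp]: "mul None f = None" "mul e None = None"
  by (simp_all add: mul_def)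

lemma mul_eq_Some:
  "mul (Some (y, x)) (Some (v, u)) = Some (p, q) \<longleftrightarrow>
     (\<exists>s. v = x @ s \<and> p = y @ s \<and> q = u) \<or> (\<exists>s. x = v @ s \<and> p = y \<and> q = u @ s)"
proof (cases "foldr act (map Neg (rev x)) (Some (v, u))")
  case None
  then have "\<nexists>p q. foldr act (map Neg (rev x)) (Some (v, u)) = Some (p, q)" by simp
  with None show ?thesis
    unfolding foldr_act_Neg_eq_Some by (auto simp: mul_def)
next
  case (Some r)
  obtain p' q' where r: "r = (p', q')" by fastforce
  have *: "foldr act (map Neg (rev x)) (Some (v, u)) = Some (p', q')"
    using Some r by simp
  then have "mul (Some (y, x)) (Some (v, u)) = Some (y @ p', q')"
    by (simp add: mul_def foldr_act_Pos)
  with * show ?thesis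
    unfolding foldr_act_Neg_eq_Some by auto
qed

lemma mul_eq_None:
  "mul (Some (y, x)) (Some (v, u)) = None \<longleftrightarrow> (\<nexists>s. v = x @ s) \<and> (\<nexists>s. x = v @ s)"
proof -
  have "mul (Some (y, x)) (Some (v, u)) = None \<longleftrightarrow>
      (\<forall>p q. mul (Some (y, x)) (Some (v, u)) \<noteq> Some (p, q))"
    by (metis not_None_eq surj_pair)
  also have "\<dots> \<longleftrightarrow> (\<nexists>s. v = x @ s) \<and> (\<nexists>s. x = v @ s)"
    unfolding mul_eq_Some by blast
  finally show ?thesis .
qed

text \<open>The defining relations hold for the action, so evaluation is an invariant of the
  congruence. Together with \<open>eval_word_of\<close> this yields uniqueness of normal forms, in
  place of a confluence argument.\<close>

lemma act_rule: "pc_rule n l r \<Longrightarrow> foldr act l e = foldr act r e"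
proof (induction rule: pc_rule.induct)
  case (cancel i)
  then show ?case by (cases e) auto
next
  case (clash i j)
  then show ?case by (cases e) auto
qed simp_all

lemma act_step: "pc_step n u v \<Longrightarrow> foldr act u e = foldr act v e"
  by (induction rule: pc_step.induct) (simp add: act_rule)

lemma act_steps: "(pc_step n)\<^sup>*\<^sup>* u v \<Longrightarrow> foldr act u e = foldr act v e"
  by (induction rule: rtranclp_induct) (auto simp: act_step)

lemma eval_word_of [simp]: "eval_word (word_of e) = e"
proof (cases e rule: word_of.cases)
  case (2 y x)
  have "foldr act (map Neg (rev x)) (Some ([], [])) = Some ([], x)"
    by (simp add: foldr_act_Neg_eq_Some)
  with 2 show ?thesis by (simp add: eval_word_def foldr_act_Pos)
qed (simp add: eval_word_def)

lemma word_of_inject [simp]: "word_of e = word_of f \<longleftrightarrow> e = f"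
  by (metis eval_word_of)

lemma word_of_in_lists [simp]: "e \<in> elems n \<Longrightarrow> word_of e \<in> lists (Sigma0 n)"
  by (cases e rule: word_of.cases) (auto simp: Sigma0_def A_pos_def A_neg_def)

lemma act_in_elems: "c \<in> Sigma0 n \<Longrightarrow> e \<in> elems n \<Longrightarrow> act c e \<in> elems n"
  by (cases "(c, e)" rule: act.cases) (auto simp: Sigma0_def A_pos_def A_neg_def)

lemma eval_in_elems: "w \<in> lists (Sigma0 n) \<Longrightarrow> eval_word w \<in> elems n"
  by (induction w) (auto simp: eval_word_def act_in_elems)


section \<open>Normal forms\<close>

lemma pc_stepI:
  assumes "pc_rule n l r" "v \<in> lists (Sigma0 n)"
  shows "pc_step n (l @ v) (r @ v)"
  using pc_step.intros[of "[]" n v l r] assms by simp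

lemma pc_step_Cons:
  assumes "pc_step n u v" "c \<in> Sigma0 n"
  shows "pc_step n (c # u) (c # v)"
  using assms
proof (induction rule: pc_step.induct)
  case (1 u v l r)
  then show ?case using pc_step.intros[of "c # u" n v l r] by simp
qed

lemma pc_steps_Cons:
  assumes "(pc_step n)\<^sup>*\<^sup>* u v" "c \<in> Sigma0 n"
  shows "(pc_step n)\<^sup>*\<^sup>* (c # u) (c # v)"
  using assms(1)
  by (induction rule: rtranclp_induct)
     (auto intro: rtranclp.rtrancl_into_rtrancl pc_step_Cons assms(2))

lemma Zero_absorbs:
  "w \<in> lists (Sigma0 n) \<Longrightarrow> (pc_step n)\<^sup>*\<^sup>* (Zero # w) [Zero]"
proof (induction w)
  case (Cons c w)
  have "pc_rule n [Zero, c] [Zero]"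
    using Cons.prems by (auto simp: Sigma0_def intro: pc_rule.intros)
  then have "pc_step n (Zero # c # w) (Zero # w)"
    using pc_stepI[of n "[Zero, c]" "[Zero]" w] Cons.prems by simp
  with Cons show ?case by (auto intro: converse_rtranclp_into_rtranclp)
qed simp

text \<open>A \<open>Pos\<close> letter, or a \<open>Neg\<close> letter before an empty positive
  part, already gives a normal word. Otherwise one rule fires at the front, or a \<open>Zero\<close>
  there absorbs the rest.\<close>

lemma act_normalizes:
  assumes "c \<in> Sigma0 n" "e \<in> elems n"
  shows "(pc_step n)\<^sup>*\<^sup>* (c # word_of e) (word_of (act c e))"
proof (cases "(c, e)" rule: act.cases)
  case (1 c')
  have "pc_rule n [c, Zero] [Zero]"
    using assms(1) by (auto simp: Sigma0_def intro: pc_rule.intros)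
  then show ?thesis using pc_stepI[of n "[c, Zero]" "[Zero]" "[]"] 1 by auto
next
  case (4 i j y x)
  have ij: "i \<in> {1..n}" "j \<in> {1..n}" and w: "word_of (Some (y, x)) \<in> lists (Sigma0 n)"
    using assms 4 by (auto simp: Sigma0_def A_pos_def A_neg_def)
  show ?thesis
  proof (cases "i = j")
    case True
    then show ?thesis
      using pc_stepI[OF pc_rule.cancel[OF ij(1)] w] 4 by auto
  next
    case False
    have "pc_step n (c # word_of e) (Zero # word_of (Some (y, x)))"
      using pc_stepI[OF pc_rule.clash[OF ij False] w] 4 by auto
    then show ?thesis
      using Zero_absorbs[OF w] 4 False by (auto intro: converse_rtranclp_into_rtranclp)
  qed
next
  case 5
  then show ?thesis using Zero_absorbs[of "word_of e" n] assms by simp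
qed auto

lemma normalizes:
  "w \<in> lists (Sigma0 n) \<Longrightarrow> (pc_step n)\<^sup>*\<^sup>* w (word_of (eval_word w))"
proof (induction w)
  case Nil
  then show ?case by (simp add: eval_word_def)
next
  case (Cons c w)
  have "(pc_step n)\<^sup>*\<^sup>* (c # w) (c # word_of (eval_word w))"
    using Cons by (auto intro: pc_steps_Cons)
  also have "(pc_step n)\<^sup>*\<^sup>* \<dots> (word_of (act c (eval_word w)))"
    using Cons.prems by (auto intro: act_normalizes eval_in_elems)
  finally show ?case by (simp add: eval_word_def)
qed

lemma pc_step_shortens: "pc_step n u v \<Longrightarrow> length v < length u"
  by (induction rule: pc_step.induct) (auto elim: pc_rule.cases)

lemma pc_step_in_lists: "pc_step n u v \<Longrightarrow> v \<in> lists (Sigma0 n)"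
  by (induction rule: pc_step.induct) (auto elim!: pc_rule.cases simp: Sigma0_def)

lemma length_word_of_eval:
  assumes "w \<in> lists (Sigma0 n)"
  shows "length (word_of (eval_word w)) \<le> length w"
  using normalizes[OF assms]
  by (induction rule: rtranclp_induct) (auto dest: pc_step_shortens)

text \<open>A normal form is a shortest word of its class, whereas every rewriting step shortens.\<close>

lemma irreducible_iff:
  "irreducible_word n w \<longleftrightarrow> w \<in> lists (Sigma0 n) \<and> w = word_of (eval_word w)"
proof (intro iffI conjI)
  assume w: "irreducible_word n w"
  then show l: "w \<in> lists (Sigma0 n)" by (simp add: irreducible_word_def)
  show "w = word_of (eval_word w)"
    using normalizes[OF l] w by (auto simp: irreducible_word_def elim: converse_rtranclpE)
next
  assume w: "w \<in> lists (Sigma0 n) \<and> w = word_of (eval_word w)"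
  have False if "pc_step n w v" for v
  proof -
    have "eval_word v = eval_word w"
      using act_step[OF that] by (simp add: eval_word_def)
    then have "length w \<le> length v"
      using length_word_of_eval[OF pc_step_in_lists[OF that]] w by simp
    with pc_step_shortens[OF that] show False by simp
  qed
  with w show "irreducible_word n w" by (auto simp: irreducible_word_def)
qed

section \<open>The quotient monoid in terms of pairs\<close>

lemma pc_cong_iff:
  "(u, v) \<in> pc_cong n \<longleftrightarrow>
     u \<in> lists (Sigma0 n) \<and> v \<in> lists (Sigma0 n) \<and> eval_word u = eval_word v"
proof -
  have "eval_word u = eval_word v" if "equivclp (pc_step n) u v"
    using that
    by (induction rule: equivclp_induct) (auto simp: eval_word_def act_step)
  \<comment> \<open>Both words rewrite to the \<open>word_of\<close> of their common value.\<close>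
  moreover have "equivclp (pc_step n) u v"
    if "u \<in> lists (Sigma0 n)" "v \<in> lists (Sigma0 n)" "eval_word u = eval_word v"
  proof -
    have "equivclp (pc_step n) u (word_of (eval_word u))"
      "equivclp (pc_step n) v (word_of (eval_word v))"
      using normalizes[OF that(1)] normalizes[OF that(2)]
      by (auto intro: predicate2D[OF rtranlcp_le_equivclp])
    then show ?thesis using that(3) by (metis equivclp_sym equivclp_trans)
  qed
  ultimately show ?thesis by (auto simp: pc_cong_def)
qed

text \<open>The bridge to the quotient: on \<open>elems n\<close> this is a bijection onto the
  carrier, and it turns \<open>mul\<close> into the product of classes.\<close>

definition cls :: "nat \<Rightarrow> elt \<Rightarrow> letter list set" where
  "cls n e = {w \<in> lists (Sigma0 n). eval_word w = e}"

lemma pc_cong_Image: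
  "w \<in> lists (Sigma0 n) \<Longrightarrow> pc_cong n `` {w} = cls n (eval_word w)"
  by (auto simp: cls_def pc_cong_iff)

lemma word_of_in_cls: "e \<in> elems n \<Longrightarrow> word_of e \<in> cls n e"
  by (simp add: cls_def)

lemma cls_inject: "e \<in> elems n \<Longrightarrow> f \<in> elems n \<Longrightarrow> cls n e = cls n f \<longleftrightarrow> e = f"
  by (metis (mono_tags, lifting) cls_def eval_word_of mem_Collect_eq word_of_in_cls)

lemma carrier_polycyclic: "carrier (polycyclic n) = cls n ` elems n"
proof
  show "carrier (polycyclic n) \<subseteq> cls n ` elems n"
  proof
    fix A assume "A \<in> carrier (polycyclic n)"
    then have "A \<in> lists (Sigma0 n) // pc_cong n" by (simp add: polycyclic_def)
    then obtain w where w: "w \<in> lists (Sigma0 n)" "A = pc_cong n `` {w}"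
      by (rule quotientE)
    then show "A \<in> cls n ` elems n"
      using eval_in_elems[OF w(1)] by (simp add: pc_cong_Image)
  qed
  show "cls n ` elems n \<subseteq> carrier (polycyclic n)"
  proof clarify
    fix e assume e: "e \<in> elems n"
    have "pc_cong n `` {word_of e} \<in> lists (Sigma0 n) // pc_cong n"
      using e by (intro quotientI) simp
    then show "cls n e \<in> carrier (polycyclic n)"
      using e by (simp add: polycyclic_def pc_cong_Image)
  qed
qed

text \<open>Since \<open>u\<close> rewrites to its normal word, the two act alike on the value of
  \<open>v\<close>, and \<open>mul\<close> is defined by the action of the normal word.\<close>

lemma eval_append:
  assumes "u \<in> lists (Sigma0 n)"
  shows "eval_word (u @ v) = mul (eval_word u) (eval_word v)"
proof -
  have "eval_word (u @ v) = foldr act u (eval_word v)"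
    by (simp add: eval_word_def)
  also have "\<dots> = mul (eval_word u) (eval_word v)"
    unfolding mul_def by (rule act_steps[OF normalizes[OF assms]])
  finally show ?thesis .
qed

lemma mul_in_elems: "e \<in> elems n \<Longrightarrow> f \<in> elems n \<Longrightarrow> mul e f \<in> elems n"
  using eval_in_elems[of "word_of e @ word_of f" n] eval_append[of "word_of e" n "word_of f"]
  by simp

lemma mult_cls:
  assumes "e \<in> elems n" "f \<in> elems n"
  shows "cls n e \<otimes>\<^bsub>polycyclic n\<^esub> cls n f = cls n (mul e f)"
proof -
  have "pc_cong n `` {u @ v} = cls n (mul e f)" if "u \<in> cls n e" "v \<in> cls n f" for u v
  proof -
    have "u \<in> lists (Sigma0 n)" "v \<in> lists (Sigma0 n)" "eval_word u = e" "eval_word v = f"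
      using that unfolding cls_def by blast+
    then show ?thesis by (metis append_in_lists_conv eval_append pc_cong_Image)
  qed
  then have "cls n e \<otimes>\<^bsub>polycyclic n\<^esub> cls n f = (\<Union>u\<in>cls n e. \<Union>v\<in>cls n f. cls n (mul e f))"
    unfolding polycyclic_def by simp
  also have "\<dots> = cls n (mul e f)"
    using word_of_in_cls[OF assms(1)] word_of_in_cls[OF assms(2)] by auto
  finally show ?thesis .
qed

lemma pc_zero_eq: "pc_zero n = cls n None"
  by (simp add: pc_zero_def pc_cong_Image Sigma0_def eval_word_def)

lemma normal_form_cls: "e \<in> elems n \<Longrightarrow> normal_form n (cls n e) = word_of e"
  unfolding normal_form_def
  by (rule the_equality) (auto simp: cls_def irreducible_iff)


section \<open>Cores\<close>

text \<open>Removal of the longest common prefix. As (r s)(r t)\<inverse> = r s t\<inverse>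
  r\<inverse>, this is cyclic reduction on pairs.\<close>

fun strip :: "nat list \<Rightarrow> nat list \<Rightarrow> nat list \<times> nat list" where
  "strip (i # y) (j # x) = (if i = j then strip y x else (i # y, j # x))"
| "strip y x = (y, x)"

lemma strip_append: "strip (r @ y) (r @ x) = strip y x"
  by (induction r) auto

lemma strip_Nil [simp]: "strip [] x = ([], x)" "strip y [] = (y, [])"
  by (cases x; simp) (cases y; simp)

lemma strip_decomp: "strip y x = (s, t) \<Longrightarrow> \<exists>r. y = r @ s \<and> x = r @ t"
proof (induction y x rule: strip.induct)
  case (1 i y j x)
  then show ?case by (cases "i = j") (auto intro: exI[of _ "i # r" for r])
qed auto

lemma strip_idem: "strip y x = (s, t) \<Longrightarrow> strip s t = (s, t)"
  by (induction y x rule: strip.induct) (auto split: if_splits)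

text \<open>The ends of the word y x\<inverse> are mutually inverse only if \<open>y\<close> and
  \<open>x\<close> are both nonempty with the same first letter, which is when \<open>strip\<close>
  removes something.\<close>

lemma cyclically_reduced_iff:
  assumes "y \<in> lists {1..n}" "x \<in> lists {1..n}"
  shows "cyclically_reduced n (word_of (Some (y, x))) \<longleftrightarrow> strip y x = (y, x)"
proof -
  \<comment> \<open>\<open>strip\<close> returns suffixes of its arguments, so it never gives back
    the longer words \<open>i # y'\<close> and \<open>i # x'\<close>.\<close>
  have "strip y' x' \<noteq> (i # y', i # x')" for i y' x'
    using strip_decomp[of y' x' "i # y'" "i # x'"] by fastforce
  moreover have "word_of (Some (y, x)) \<in> lists (Sigma0 n)"
    using assms by (intro word_of_in_lists) simp
  ultimately show ?thesis
    unfolding cyclically_reduced_def irreducible_iff eval_word_of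
    by (cases y; cases x) (auto simp: last_map hd_map hd_append last_append last_rev hd_rev)
qed

lemma inv_word_Pos: "inv_word (map Pos x) = map Neg (rev x)"
  by (induction x) auto

lemma lists_A_pos: "lists (A_pos n) = map Pos ` lists {1..n}"
  by (simp add: A_pos_def lists_image)

text \<open>The common prefix of \<open>y\<close> and \<open>x\<close> supplies the outer word
  \<open>r\<close>. The core is unique because stripping \<open>r' @ s'\<close> and
  \<open>r' @ t'\<close> gives the same result as stripping \<open>s'\<close> and
  \<open>t'\<close>.\<close>

lemma core_word_of:
  assumes "y \<in> lists {1..n}" "x \<in> lists {1..n}"
  shows "core n (word_of (Some (y, x))) = word_of (Some (strip y x))"
proof (cases "cyclically_reduced n (word_of (Some (y, x)))")
  case True
  then show ?thesis using cyclically_reduced_iff[OF assms] by (simp add: core_def)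
next
  case False
  obtain s t where st: "strip y x = (s, t)" by fastforce
  obtain r where r: "y = r @ s" "x = r @ t" using strip_decomp[OF st] by blast
  have mem: "r \<in> lists {1..n}" "s \<in> lists {1..n}" "t \<in> lists {1..n}"
    using assms r by auto
  have decomp: "word_of (Some (y, x)) = map Pos r' @ (map Pos s' @ inv_word (map Pos t')) @ inv_word (map Pos r')
      \<longleftrightarrow> y = r' @ s' \<and> x = r' @ t'" for r' s' t'
  proof -
    have "map Pos r' @ (map Pos s' @ inv_word (map Pos t')) @ inv_word (map Pos r') =
        word_of (Some (r' @ s', r' @ t'))"
      by (simp add: inv_word_Pos)
    then show ?thesis by (simp only: word_of_inject) auto
  qed
  have cr: "cyclically_reduced n (map Pos s' @ inv_word (map Pos t')) \<longleftrightarrow> strip s' t' = (s', t')"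
    if "s' \<in> lists {1..n}" "t' \<in> lists {1..n}" for s' t'
    using cyclically_reduced_iff[OF that] by (simp add: inv_word_Pos)
  have "(THE c. \<exists>r\<in>lists (A_pos n). \<exists>x'\<in>lists (A_pos n). \<exists>y'\<in>lists (A_pos n).
      c = y' @ inv_word x' \<and> cyclically_reduced n c \<and>
      word_of (Some (y, x)) = r @ c @ inv_word r) = word_of (Some (s, t))"
  proof (rule the_equality)
    show "\<exists>r\<in>lists (A_pos n). \<exists>x'\<in>lists (A_pos n). \<exists>y'\<in>lists (A_pos n).
      word_of (Some (s, t)) = y' @ inv_word x' \<and> cyclically_reduced n (word_of (Some (s, t))) \<and>
      word_of (Some (y, x)) = r @ word_of (Some (s, t)) @ inv_word r"
      unfolding lists_A_pos
      using mem r strip_idem[OF st] cyclically_reduced_iff[OF mem(2,3)]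
      by (intro bexI[of _ "map Pos r"] bexI[of _ "map Pos s"] bexI[of _ "map Pos t"] imageI)
         (auto simp: inv_word_Pos)
  next
    fix c
    assume "\<exists>r\<in>lists (A_pos n). \<exists>x'\<in>lists (A_pos n). \<exists>y'\<in>lists (A_pos n).
      c = y' @ inv_word x' \<and> cyclically_reduced n c \<and> word_of (Some (y, x)) = r @ c @ inv_word r"
    then obtain r' s' t' where *: "s' \<in> lists {1..n}" "t' \<in> lists {1..n}"
      "c = map Pos s' @ inv_word (map Pos t')" "cyclically_reduced n c"
      "word_of (Some (y, x)) = map Pos r' @ c @ inv_word (map Pos r')"
      unfolding lists_A_pos by blast
    then have "y = r' @ s'" "x = r' @ t'" "strip s' t' = (s', t')"
      using decomp cr by blast+
    with st have "s' = s" "t' = t" by (auto simp: strip_append)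
    with *(3) show "c = word_of (Some (s, t))" by (simp add: inv_word_Pos)
  qed
  with False st show ?thesis by (simp add: core_def)
qed

lemma tilde_Some:
  assumes "Some (y, x) \<in> elems n"
  shows "tilde n (cls n (Some (y, x))) = word_of (Some (strip y x))"
  using assms normal_form_cls[OF assms] core_word_of by (simp add: tilde_def)

lemma tilde_None: "tilde n (cls n None) = [Zero]"
proof -
  have "cyclically_reduced n [Zero]"
    using irreducible_iff[of n "[Zero]"]
    by (simp add: cyclically_reduced_def Sigma0_def eval_word_def)
  then show ?thesis using normal_form_cls[of None n] by (simp add: tilde_def core_def)
qed


section \<open>Conjugators\<close>

lemma is_zero_cls:
  assumes "e \<in> elems n"
  shows "is_zero (polycyclic n) (cls n e) \<longleftrightarrow> e = None"
proof
  assume "is_zero (polycyclic n) (cls n e)"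
  then have "cls n e \<otimes>\<^bsub>polycyclic n\<^esub> cls n None = cls n e"
    by (simp add: is_zero_def carrier_polycyclic)
  with assms show "e = None" by (simp add: mult_cls cls_inject)
next
  assume "e = None"
  then show "is_zero (polycyclic n) (cls n e)"
    by (auto simp: is_zero_def carrier_polycyclic mult_cls)
qed

lemma conjugators_None: "conjugators (polycyclic n) (cls n None) = {cls n None}"
  using is_zero_cls[of None n] by (auto simp: conjugators_def)

lemma conjugators_Some_iff:
  assumes n: "n \<ge> 2" and e: "Some (y, x) \<in> elems n" and g: "g \<in> elems n"
  shows "cls n g \<in> conjugators (polycyclic n) (cls n (Some (y, x))) \<longleftrightarrow>
    (\<exists>v u t. g = Some (v, u) \<and> x = v @ t)"
proof -
  have "cls n g \<in> conjugators (polycyclic n) (cls n (Some (y, x))) \<longleftrightarrow>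
      (\<forall>m\<in>elems n. mul (mul m (Some (y, x))) g = None \<longrightarrow> mul m (Some (y, x)) = None)"
  proof -
    have "\<exists>z. is_zero (polycyclic n) z"
      using is_zero_cls[of None n] by auto
    moreover have "\<not> is_zero (polycyclic n) (cls n (Some (y, x)))"
      using is_zero_cls[OF e] by simp
    ultimately show ?thesis
      using e g unfolding conjugators_def
      by (simp add: carrier_polycyclic mult_cls is_zero_cls mul_in_elems del: Some_in_elems)
  qed
  also have "\<dots> \<longleftrightarrow> (\<exists>v u t. g = Some (v, u) \<and> x = v @ t)"
  proof
    assume *: "\<forall>m\<in>elems n. mul (mul m (Some (y, x))) g = None \<longrightarrow> mul m (Some (y, x)) = None"
    \<comment> \<open>Test with m = (y s)\<inverse>: then m y x\<inverse> = (x s)\<inverse>, an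
      arbitrary extension of \<open>x\<close> in the negative part.\<close>
    have ext: "mul (Some ([], x @ s)) g \<noteq> None" if "s \<in> lists {1..n}" for s
    proof -
      have m: "mul (Some ([], y @ s)) (Some (y, x)) = Some ([], x @ s)"
        by (simp add: mul_eq_Some)
      moreover have "Some ([], y @ s) \<in> elems n" using e that by simp
      ultimately show ?thesis using * by fastforce
    qed
    obtain v u where vu: "g = Some (v, u)"
      using ext[of "[]"] by (cases g) auto
    have "\<exists>t. x = v @ t"
    proof (rule ccontr)
      assume no: "\<nexists>t. x = v @ t"
      then obtain k s where v: "v = x @ k # s"
        using ext[of "[]"] vu unfolding vu by (auto simp: mul_eq_None neq_Nil_conv)
      \<comment> \<open>Two generators provide a letter \<open>k'\<close> other than
        \<open>k\<close>; then \<open>x @ [k']\<close> and \<open>v = x @ k # s\<close> are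
        incomparable, and the product in \<open>ext\<close> vanishes.\<close>
      have "(if k = 1 then 2 else 1) \<in> {1..n}" "(if k = 1 then 2 else 1) \<noteq> k"
        using n by auto
      then obtain k' where "k' \<in> {1..n}" "k' \<noteq> k" by blast
      then show False using ext[of "[k']"] vu v by (auto simp: mul_eq_None)
    qed
    with vu show "\<exists>v u t. g = Some (v, u) \<and> x = v @ t" by blast
  next
    assume "\<exists>v u t. g = Some (v, u) \<and> x = v @ t"
    then obtain v u t where g: "g = Some (v, u)" and x: "x = v @ t" by blast
    show "\<forall>m\<in>elems n. mul (mul m (Some (y, x))) g = None \<longrightarrow> mul m (Some (y, x)) = None"
    proof (intro ballI impI, rule ccontr)
      fix m
      assume 0: "mul (mul m (Some (y, x))) g = None" and "mul m (Some (y, x)) \<noteq> None"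
      then obtain p q where pq: "mul m (Some (y, x)) = Some (p, q)" by auto
      then obtain p' q' where "m = Some (p', q')" by (cases m) auto
      \<comment> \<open>A nonzero left multiple keeps \<open>x\<close>, hence also \<open>v\<close>,
        as a prefix of its negative part.\<close>
      with pq obtain s where "q = x @ s" by (auto simp: mul_eq_Some)
      with 0 pq g x show False by (auto simp: mul_eq_None)
    qed
  qed
  finally show ?thesis .
qed

section \<open>Solving the conjugacy equation\<close>

lemma intertwine_iff:
  "mul (Some (y, v @ t)) (Some (v, u)) = mul (Some (v, u)) (Some (y', x')) \<longleftrightarrow>
    (\<exists>s. y = v @ s \<and> y' = u @ s \<and> x' = u @ t) \<or> (\<exists>s. y = v \<and> u = y' @ s \<and> u @ t = x' @ s)"
proof -
  \<comment> \<open>The left side is nonzero, so \<open>u\<close> and \<open>y'\<close> must be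
    comparable; the two disjuncts are the two directions of the prefix relation.\<close>
  have "mul (Some (y, v @ t)) (Some (v, u)) = Some (y, u @ t)"
    by (simp add: mul_eq_Some)
  then show ?thesis
    using mul_eq_Some[of v u y' x' y "u @ t"] by (metis (no_types))
qed

text \<open>Compare \<open>s\<close> with \<open>t'\<close>: if \<open>t'\<close> is a prefix of
  \<open>s\<close>, cancelling it leaves the same equation for a shorter \<open>s\<close>; otherwise
  \<open>t' = s @ p\<close> and \<open>t = p @ s\<close>.\<close>

lemma intertwined_words_conjugate:
  "s @ t = t' @ s \<Longrightarrow> \<exists>p q. t = p @ q \<and> t' = q @ p"
proof (induction s rule: length_induct)
  case (1 s)
  from "1.prems" consider (short) s' where "s = t' @ s'" "s' @ t = s"
    | (long) p where "t' = s @ p" "t = p @ s"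
    by (auto simp: append_eq_append_conv2)
  then show ?case
  proof cases
    case short
    \<comment> \<open>For empty \<open>t'\<close> the word \<open>s\<close> would not shrink, but
      then \<open>t\<close> is empty as well.\<close>
    show ?thesis
    proof (cases "t' = []")
      case False
      with short have "length s' < length s" "s' @ t = t' @ s'" by auto
      with "1.IH" show ?thesis by blast
    qed (use "1.prems" in auto)
  next
    case long
    then show ?thesis by blast
  qed
qed

text \<open>Inversion reverses products, so it swaps the two factors and carries cyclic shifts to
  cyclic shifts.\<close>

lemma sim_p_Neg_iff:
  assumes "t \<in> lists {1..n}"
  shows "sim_p (free_monoid (A_neg n)) (map Neg (rev t)) (map Neg (rev t')) \<longleftrightarrow>
    (\<exists>p q. t = p @ q \<and> t' = q @ p)"
proof
  assume "sim_p (free_monoid (A_neg n)) (map Neg (rev t)) (map Neg (rev t'))"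
  then obtain u v where uv: "map Neg (rev t) = u @ v" "map Neg (rev t') = v @ u"
    by (auto simp: sim_p_def free_monoid_def)
  obtain p q where pq: "u = map Neg p" "v = map Neg q"
    using uv(1) by (auto simp: map_eq_append_conv)
  have "inj (map Neg)" by (intro inj_mapI injI) simp
  then have "rev t = p @ q" "rev t' = q @ p"
    using uv unfolding pq by (simp_all flip: map_append add: inj_eq)
  then have "t = rev q @ rev p" "t' = rev p @ rev q"
    by (metis rev_append rev_rev_ident)+
  then show "\<exists>p q. t = p @ q \<and> t' = q @ p" by blast
next
  assume "\<exists>p q. t = p @ q \<and> t' = q @ p"
  then obtain p q where "t = p @ q" "t' = q @ p" by blast
  with assms show "sim_p (free_monoid (A_neg n)) (map Neg (rev t)) (map Neg (rev t'))"
    unfolding sim_p_def free_monoid_def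
    by (intro bexI[of _ "map Neg (rev q)"] bexI[of _ "map Neg (rev p)"])
       (auto simp: A_neg_def)
qed

lemma sim_c_Some_iff:
  assumes n: "n \<ge> 2" and e: "Some (y, x) \<in> elems n" and f: "Some (y', x') \<in> elems n"
  shows "sim_c (polycyclic n) (cls n (Some (y, x))) (cls n (Some (y', x'))) \<longleftrightarrow>
    strip y x = strip y' x' \<or>
    (\<exists>p q. strip y x = ([], p @ q) \<and> strip y' x' = ([], q @ p))"
    (is "?sim \<longleftrightarrow> ?eq \<or> ?conj")
proof
  assume ?sim
  then obtain G where G: "G \<in> conjugators (polycyclic n) (cls n (Some (y, x)))"
    and eq: "cls n (Some (y, x)) \<otimes>\<^bsub>polycyclic n\<^esub> G = G \<otimes>\<^bsub>polycyclic n\<^esub> cls n (Some (y', x'))"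
    unfolding sim_c_def by blast
  have "G \<in> carrier (polycyclic n)"
    using G is_zero_cls[OF e] by (auto simp: conjugators_def split: if_splits)
  then obtain g where g: "G = cls n g" "g \<in> elems n"
    by (auto simp: carrier_polycyclic)
  obtain v u t where vut: "g = Some (v, u)" "x = v @ t"
    using G unfolding g(1) conjugators_Some_iff[OF n e g(2)] by blast
  have "mul (Some (y, v @ t)) (Some (v, u)) = mul (Some (v, u)) (Some (y', x'))"
    using eq e f g vut by (simp add: mult_cls mul_in_elems cls_inject)
  then consider s where "y = v @ s" "y' = u @ s" "x' = u @ t"
    | s where "y = v" "u = y' @ s" "u @ t = x' @ s"
    unfolding intertwine_iff by blast
  then show "?eq \<or> ?conj"
  proof cases
    case 1
    with vut show ?thesis by (simp add: strip_append)
  next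
    case (2 s)
    \<comment> \<open>Comparing lengths here makes \<open>y'\<close> no longer than
      \<open>x'\<close>, hence a prefix of it; cancelling \<open>y'\<close> leaves two words
      intertwined by \<open>s\<close>.\<close>
    then have *: "y' @ s @ t = x' @ s" by simp
    then have "length y' \<le> length x'" using arg_cong[OF *, of length] unfolding length_append by linarith
    then obtain t' where t': "x' = y' @ t'"
      using * by (auto simp: append_eq_append_conv2)
    with * have "s @ t = t' @ s" by simp
    then obtain p q where "t = p @ q" "t' = q @ p"
      using intertwined_words_conjugate by blast
    moreover have "strip y x = ([], t)" "strip y' x' = ([], t')"
      using 2 vut t' strip_append[of _ "[]"] by fastforce+
    ultimately show ?thesis by blast
  qed
next
  have sim_cI: ?sim
    if g: "Some (v, u) \<in> elems n" "x = v @ t"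
      "mul (Some (y, x)) (Some (v, u)) = mul (Some (v, u)) (Some (y', x'))"
    and h: "Some (v', u') \<in> elems n" "x' = v' @ t'"
      "mul (Some (y', x')) (Some (v', u')) = mul (Some (v', u')) (Some (y, x))"
    for v u t v' u' t'
    unfolding sim_c_def using g h e f
    by (intro conjI bexI[of _ "cls n (Some (v, u))"] bexI[of _ "cls n (Some (v', u'))"])
       (auto simp: carrier_polycyclic mult_cls conjugators_Some_iff[OF n])
  obtain s t where st: "strip y x = (s, t)" by fastforce
  obtain s' t' where st': "strip y' x' = (s', t')" by fastforce
  obtain v where v: "y = v @ s" "x = v @ t" using strip_decomp[OF st] by blast
  obtain u where u: "y' = u @ s'" "x' = u @ t'" using strip_decomp[OF st'] by blast
  assume "?eq \<or> ?conj"
  then show ?sim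
  proof
    assume ?eq
    with st st' have "s' = s" "t' = t" by auto
    \<comment> \<open>The conjugators v u\<inverse> and u v\<inverse> exchange the outer words
      \<open>v\<close> and \<open>u\<close> around the common core.\<close>
    then show ?sim
      using v u e f by (intro sim_cI[of v u t u v t']) (auto simp: intertwine_iff)
  next
    assume ?conj
    then obtain p q where pq: "s = []" "t = p @ q" "s' = []" "t' = q @ p"
      using st st' by auto
    \<comment> \<open>The conjugators are v (u q)\<inverse> and u (v p)\<inverse>; they work because
      q (p q) = (q p) q and p (q p) = (p q) p.\<close>
    show ?sim
      using v u e f pq by (intro sim_cI[of v "u @ q" t u "v @ p" t'])
        (auto simp: intertwine_iff)
  qed
qed

text \<open>An admissible conjugator of a nonzero element has a nonzero product with it, whereas
  multiplying the conjugator by zero gives zero.\<close>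

lemma sim_c_None_Some:
  assumes n: "n \<ge> 2" and e: "Some (y, x) \<in> elems n"
  shows "\<not> sim_c (polycyclic n) (cls n None) (cls n (Some (y, x)))"
    and "\<not> sim_c (polycyclic n) (cls n (Some (y, x))) (cls n None)"
proof -
  have no: False if H: "H \<in> conjugators (polycyclic n) (cls n (Some (y, x)))"
    "cls n (Some (y, x)) \<otimes>\<^bsub>polycyclic n\<^esub> H = H \<otimes>\<^bsub>polycyclic n\<^esub> cls n None" for H
  proof -
    have "H \<in> carrier (polycyclic n)"
      using H(1) is_zero_cls[OF e] by (auto simp: conjugators_def split: if_splits)
    then obtain h where h: "H = cls n h" "h \<in> elems n"
      by (auto simp: carrier_polycyclic)
    obtain v u t where "h = Some (v, u)" "x = v @ t"
      using H(1) unfolding h(1) conjugators_Some_iff[OF n e h(2)] by blast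
    then show False
      using H(2) e h(2) unfolding h(1)
      by (simp add: mult_cls cls_inject mul_in_elems mul_eq_None del: Some_in_elems)
  qed
  show "\<not> sim_c (polycyclic n) (cls n None) (cls n (Some (y, x)))"
    unfolding sim_c_def using no by blast
  show "\<not> sim_c (polycyclic n) (cls n (Some (y, x))) (cls n None)"
    unfolding sim_c_def using no by blast
qed

section \<open>Translation back to cyclically reduced words\<close>

theorem theorem3p9:
  fixes n :: nat and a b :: "letter list set"
  assumes "n \<ge> 2"
    and "a \<in> carrier (polycyclic n)"
    and "b \<in> carrier (polycyclic n)"
  shows "sim_c (polycyclic n) a b \<longleftrightarrow>
      (a = pc_zero n \<and> b = pc_zero n)
    \<or> tilde n a = tilde n b
    \<or> (tilde n a \<in> lists (A_neg n) \<and> tilde n b \<in> lists (A_neg n)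
        \<and> sim_p (free_monoid (A_neg n)) (tilde n a) (tilde n b))"
proof -
  obtain e f where a: "a = cls n e" "e \<in> elems n" and b: "b = cls n f" "f \<in> elems n"
    using assms by (auto simp: carrier_polycyclic)
  \<comment> \<open>With \<open>Zero_Neg\<close>, this makes all three conditions fail when exactly
    one of the elements is zero.\<close>
  have Zero: "word_of (Some z) \<noteq> [Zero]" "[Zero] \<noteq> word_of (Some z)" for z
    using word_of_inject[of "Some z" None] by auto
  have Zero_Neg: "[Zero] \<notin> lists (A_neg n)"
    by (auto simp: A_neg_def)
  consider (zz) "e = None" "f = None"
    | (zs) y x where "e = None" "f = Some (y, x)"
    | (sz) y x where "e = Some (y, x)" "f = None"
    | (ss) y x y' x' where "e = Some (y, x)" "f = Some (y', x')"
    by (cases e; cases f) auto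
  then show ?thesis
  proof cases
    case zz
    have "sim_c (polycyclic n) a b"
      using a b zz by (auto simp: sim_c_def conjugators_None carrier_polycyclic)
    then show ?thesis using a b zz by (simp add: pc_zero_eq)
  next
    case zs
    then show ?thesis
      using a b sim_c_None_Some(1)[OF assms(1), of y x] Zero Zero_Neg cls_inject[of f n None]
      by (simp add: pc_zero_eq tilde_None tilde_Some del: word_of.simps Some_in_elems in_lists_conv_set)
  next
    case sz
    then show ?thesis
      using a b sim_c_None_Some(2)[OF assms(1), of y x] Zero Zero_Neg cls_inject[of e n None]
      by (simp add: pc_zero_eq tilde_None tilde_Some del: word_of.simps Some_in_elems in_lists_conv_set)
  next
    case ss
    obtain s t where st: "strip y x = (s, t)" by fastforce
    obtain s' t' where st': "strip y' x' = (s', t')" by fastforce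
    have mem: "s \<in> lists {1..n}" "t \<in> lists {1..n}" "s' \<in> lists {1..n}" "t' \<in> lists {1..n}"
      using strip_decomp[OF st] strip_decomp[OF st'] a b ss by auto
    \<comment> \<open>This identifies condition (c) with the case of two empty positive parts in
      \<open>sim_c_Some_iff\<close>.\<close>
    have Neg: "word_of (Some (p, q)) \<in> lists (A_neg n) \<longleftrightarrow> p = []"
      if "q \<in> lists {1..n}" for p q
      using that by (cases p) (auto simp: A_neg_def)
    have tilde: "tilde n a = word_of (Some (s, t))" "tilde n b = word_of (Some (s', t'))"
      using a b ss st st' tilde_Some by auto
    have "a \<noteq> pc_zero n"
      using a b ss cls_inject[of e n None] by (simp add: pc_zero_eq)
    moreover have "sim_c (polycyclic n) a b \<longleftrightarrow>
        s = s' \<and> t = t' \<or> s = [] \<and> s' = [] \<and> (\<exists>p q. t = p @ q \<and> t' = q @ p)"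
      using sim_c_Some_iff[OF assms(1), of y x y' x'] a b ss st st' by auto
    moreover have "tilde n a = tilde n b \<longleftrightarrow> s = s' \<and> t = t'"
      unfolding tilde word_of_inject by simp
    moreover have "tilde n a \<in> lists (A_neg n) \<and> tilde n b \<in> lists (A_neg n)
        \<and> sim_p (free_monoid (A_neg n)) (tilde n a) (tilde n b) \<longleftrightarrow>
        s = [] \<and> s' = [] \<and> (\<exists>p q. t = p @ q \<and> t' = q @ p)"
      unfolding tilde Neg[OF mem(2)] Neg[OF mem(4)]
      using sim_p_Neg_iff[OF mem(2), of t'] by auto
    ultimately show ?thesis by blast
  qed
qed

end
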